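(* Let $\hat X^{(n)}(\cdot)$, $n\ge n_0$, be a family of Markov chains with drift functions $v^{(n)}$ on sets $\mathcal{X}^{(n)}\subseteq\mathbb{R}^I$ and drift-based fluid limits $y^{(n)}(\cdot)$, satisfying all the assumptions listed in the context. For a continuous non-negative function $g$ on $\mathbb{R}^I$ let $$G^{(n)}(x)=\int_0^\infty g(y^{(n)}(t))\,dt,\qquad y^{(n)}(0)=x\in\mathcal{X}^{(n)}.$$ Suppose that for any $C_1>0$ there exist a function $g(x)$, $x\in\mathbb{R}^I$, and a constant $C_2>0$ such that the following conditions (i) and (ii) hold. (i) The function $g$ is Lipschitz continuous, non-negative, and such that $g(x)\to\infty$ as $x\to\infty$. (ii) For any $n$, the function $G^{(n)}(x)$, $x\in\mathcal{X}^{(n)}$, is finite for all $x$ and has continuous gradient $\nabla G^{(n)}(x)$; for any $n$, any $x$ and any fixed unit-length vectors $z,z_*\in\mathbb{R}^I$, $$\limsup_{\delta\downarrow0}\frac1\delta\left|\nabla_zG^{(n)}(x+z_*\delta)-\nabla_zG^{(n)}(x)\right|\le C_1g(x)+C_2;$$ and $$G^{(n)}(x)\to\infty\ \text{ as } x\to\infty,\quad\text{uniformly in } n.$$ Then $$\sup_n\mathbb{E}\,g(\hat X^{(n)}(\infty))<\infty .$$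
   Context: Setting and assumptions. $I\ge1$ is a fixed integer; $|\cdot|$ is the Euclidean norm on $\mathbb{R}^I$ (unit-length is meant in this norm). For each positive integer $n\ge n_0$ (where the number $n_0$ is fixed), $\hat X^{(n)}(t)$, $t\ge0$, is a continuous-time Markov chain with countable state space $$\mathcal{S}^{(n)}=\{L_nx: x\in\mathbb{Z}^I\}\cap\mathcal{X}^{(n)},$$ where $\mathcal{X}^{(n)}$ is a convex closed subset of $\mathbb{R}^I$ containing $0$, and $L_nx=x/\sqrt n+s^{(n)}$ with some fixed $s^{(n)}\in\mathbb{R}^I$. For each $n$ the chain is irreducible and positive recurrent; $\hat X^{(n)}(\infty)$ denotes a random element with its stationary distribution. The total transition rate out of any state is at most $R_1n$, and any single transition has jump size at most $R_2/\sqrt n$, where $R_1,R_2>0$ are constants independent of $n$. On $\mathcal{X}^{(n)}$ a drift function (vector field) $v^{(n)}:\mathcal{X}^{(n)}\to\mathbb{R}^I$ is given, Lipschitz continuous uniformly in $n$ (i.e. with a Lipschitz constant independent of $n$), such that at each $x\in\mathcal{S}^{(n)}$ $$v^{(n)}(x)=\sum_{x'}(x'-x)\,\nu^{(n)}(x,x'),$$ where $\nu^{(n)}(x,x')$ is the transition rate of the Markov chain from state $x$ to state $x'$. For any $x\in\mathcal{X}^{(n)}$ there is a unique solution $y^{(n)}(t)$, $t\ge0$, to the ODE $$\tfrac{d}{dt}y^{(n)}(t)=v^{(n)}(y^{(n)}(t)),\qquad y^{(n)}(0)=x,$$ and it stays within $\mathcal{X}^{(n)}$; it is called the drift-based fluid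 limit (DFL) starting from $x$. Directional derivative: for $x\in\mathcal{X}^{(n)}$ and $z\in\mathbb{R}^I$, $$\nabla_zG^{(n)}(x)=\lim_{\delta\downarrow0}\frac1\delta[G^{(n)}(x+z\delta)-G^{(n)}(x)]$$ when the limit exists; if $x$ is on the boundary of $\mathcal{X}^{(n)}$, it is also required that the direction $z$ from $x$ points into $\mathcal{X}^{(n)}$. "$x\to\infty$" means $|x|\to\infty$. *)

theory Defs
  imports "HOL-Probability.Probability"
begin

definition exit_rate :: "'a set \<Rightarrow> ('a \<Rightarrow> 'a \<Rightarrow> real) \<Rightarrow> 'a \<Rightarrow> real" where
  "exit_rate S \<nu> x = (\<Sum>\<^sub>\<infinity>x'\<in>S - {x}. \<nu> x x')"

definition trans_prob ::
    "('a \<Rightarrow> 'w measure) \<Rightarrow> (real \<Rightarrow> 'w \<Rightarrow> 'a) \<Rightarrow> real \<Rightarrow> 'a \<Rightarrow> 'a \<Rightarrow> real" where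
  "trans_prob Pr Z t x y = measure (Pr x) {\<omega> \<in> space (Pr x). Z t \<omega> = y}"

text \<open>
  \<open>Pr x\<close> is the law of the process \<open>Z\<close> started from \<open>x\<close>. The conditions are, in order: the paths
  are piecewise constant and right-continuous with finitely many jumps in bounded time intervals;
  the (time-homogeneous) Markov property in terms of finite-dimensional events; and \<open>\<nu> x x'\<close> is
  the transition rate from \<open>x\<close> to \<open>x' \<noteq> x\<close>, the total rate out of \<open>x\<close> being finite
  and equal to the sum of these rates. The diagonal values \<open>\<nu> x x\<close> are irrelevant.
\<close>

definition ctmc ::
    "'a set \<Rightarrow> ('a \<Rightarrow> 'a \<Rightarrow> real) \<Rightarrow> ('a \<Rightarrow> 'w measure) \<Rightarrow> (real \<Rightarrow> 'w \<Rightarrow> 'a) \<Rightarrow> bool" where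
  "ctmc S \<nu> Pr Z \<longleftrightarrow>
     countable S \<and>
     (\<forall>x\<in>S. prob_space (Pr x) \<and>
        (\<forall>t\<ge>0. Z t \<in> Pr x \<rightarrow>\<^sub>M count_space S) \<and>
        (AE \<omega> in Pr x. Z 0 \<omega> = x)) \<and>
     (\<forall>x\<in>S. \<forall>\<omega>\<in>space (Pr x).
        (\<forall>t\<ge>0. \<exists>\<epsilon>>0. \<forall>u\<in>{t..<t + \<epsilon>}. Z u \<omega> = Z t \<omega>) \<and>
        (\<forall>t>0. \<exists>\<epsilon>>0. \<exists>c. \<forall>u\<in>{t - \<epsilon><..<t} \<inter> {0..}. Z u \<omega> = c)) \<and>
     (\<forall>x\<in>S. \<forall>y\<in>S. \<forall>z\<in>S. \<forall>r\<ge>0. \<forall>t\<ge>0. \<forall>T f. finite T \<and> T \<subseteq> {0..r} \<longrightarrow>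
        measure (Pr x) {\<omega> \<in> space (Pr x).
            (\<forall>u\<in>T. Z u \<omega> = f u) \<and> Z r \<omega> = y \<and> Z (r + t) \<omega> = z}
        = measure (Pr x) {\<omega> \<in> space (Pr x). (\<forall>u\<in>T. Z u \<omega> = f u) \<and> Z r \<omega> = y}
            * trans_prob Pr Z t y z) \<and>
     (\<forall>x\<in>S.
        (\<forall>x'\<in>S - {x}. ((\<lambda>t. trans_prob Pr Z t x x' / t) \<longlongrightarrow> \<nu> x x') (at_right 0)) \<and>
        \<nu> x summable_on (S - {x}) \<and>
        ((\<lambda>t. (1 - trans_prob Pr Z t x x) / t) \<longlongrightarrow> exit_rate S \<nu> x) (at_right 0))"

definition ctmc_irreducible ::
    "'a set \<Rightarrow> ('a \<Rightarrow> 'w measure) \<Rightarrow> (real \<Rightarrow> 'w \<Rightarrow> 'a) \<Rightarrow> bool" where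
  "ctmc_irreducible S Pr Z \<longleftrightarrow> (\<forall>x\<in>S. \<forall>y\<in>S. \<exists>t\<ge>0. trans_prob Pr Z t x y > 0)"

text \<open>The first time at \<open>x\<close> after having left \<open>x\<close> (infinite if there is none).\<close>

definition return_time :: "(real \<Rightarrow> 'w \<Rightarrow> 'a) \<Rightarrow> 'a \<Rightarrow> 'w \<Rightarrow> ennreal" where
  "return_time Z x \<omega> =
     Inf (ennreal ` {t. 0 \<le> t \<and> Z t \<omega> = x \<and> (\<exists>u\<in>{0..<t}. Z u \<omega> \<noteq> x)})"

text \<open>An absorbing state counts, as usual, as positive recurrent.\<close>

definition ctmc_positive_recurrent ::
    "'a set \<Rightarrow> ('a \<Rightarrow> 'a \<Rightarrow> real) \<Rightarrow> ('a \<Rightarrow> 'w measure) \<Rightarrow> (real \<Rightarrow> 'w \<Rightarrow> 'a) \<Rightarrow> bool" where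
  "ctmc_positive_recurrent S \<nu> Pr Z \<longleftrightarrow>
     (\<forall>x\<in>S. exit_rate S \<nu> x = 0 \<or> (\<integral>\<^sup>+\<omega>. return_time Z x \<omega> \<partial>Pr x) < \<infinity>)"

definition stationary_distribution ::
    "'a set \<Rightarrow> ('a \<Rightarrow> 'w measure) \<Rightarrow> (real \<Rightarrow> 'w \<Rightarrow> 'a) \<Rightarrow> 'a pmf \<Rightarrow> bool" where
  "stationary_distribution S Pr Z \<pi> \<longleftrightarrow>
     set_pmf \<pi> \<subseteq> S \<and>
     (\<forall>t\<ge>0. \<forall>y\<in>S. (\<integral>x. trans_prob Pr Z t x y \<partial>measure_pmf \<pi>) = pmf \<pi> y)"

definition lattice_states :: "nat \<Rightarrow> real^'i \<Rightarrow> (real^'i) set \<Rightarrow> (real^'i) set" where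
  "lattice_states n s X = {k /\<^sub>R sqrt (real n) + s | k. \<forall>i. k $ i \<in> \<int>} \<inter> X"

definition ode_solution ::
    "'a::real_normed_vector set \<Rightarrow> ('a \<Rightarrow> 'a) \<Rightarrow> 'a \<Rightarrow> (real \<Rightarrow> 'a) \<Rightarrow> bool" where
  "ode_solution X v x y \<longleftrightarrow>
     y 0 = x \<and>
     (\<forall>t\<ge>0. y t \<in> X \<and> (y has_vector_derivative v (y t)) (at t within {0..}))"

definition is_DFL ::
    "'a::real_normed_vector set \<Rightarrow> ('a \<Rightarrow> 'a) \<Rightarrow> 'a \<Rightarrow> (real \<Rightarrow> 'a) \<Rightarrow> bool" where
  "is_DFL X v x y \<longleftrightarrow>
     ode_solution X v x y \<and> (\<forall>y'. ode_solution X v x y' \<longrightarrow> (\<forall>t\<ge>0. y' t = y t))"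

text \<open>
  In the next definition \<open>y x\<close> is the fluid limit starting from \<open>x\<close>. For continuous \<open>g \<ge> 0\<close>
  the integral is finite iff the integrand is \<open>set_integrable\<close>.
\<close>

definition fluid_cost :: "('a \<Rightarrow> real \<Rightarrow> 'a) \<Rightarrow> ('a \<Rightarrow> real) \<Rightarrow> 'a \<Rightarrow> real" where
  "fluid_cost y g x = (LBINT t:{0..}. g (y x t))"

definition points_into :: "'a::real_normed_vector set \<Rightarrow> 'a \<Rightarrow> 'a \<Rightarrow> bool" where
  "points_into X x z \<longleftrightarrow> (\<forall>\<^sub>F \<delta> in at_right (0::real). x + \<delta> *\<^sub>R z \<in> X)"

text \<open>Only meaningful if \<open>z\<close> points from \<open>x\<close> into the domain of \<open>G\<close>.\<close>

definition dir_deriv :: "('a::real_normed_vector \<Rightarrow> real) \<Rightarrow> 'a \<Rightarrow> 'a \<Rightarrow> real" where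
  "dir_deriv G z x = Lim (at_right (0::real)) (\<lambda>\<delta>. (G (x + \<delta> *\<^sub>R z) - G x) / \<delta>)"

definition has_continuous_gradient_on ::
    "('a::real_inner \<Rightarrow> real) \<Rightarrow> 'a set \<Rightarrow> bool" where
  "has_continuous_gradient_on G X \<longleftrightarrow>
     (\<exists>D. continuous_on X D \<and>
        (\<forall>x\<in>X. (G has_derivative (\<lambda>h. D x \<bullet> h)) (at x within X)))"

text \<open>
  The bound concerns all directions for which the directional derivatives involved are defined,
  that is, near the boundary only those pointing into \<open>X\<close>.
\<close>

definition second_order_bound ::
    "'a::real_normed_vector set \<Rightarrow> ('a \<Rightarrow> real) \<Rightarrow> ('a \<Rightarrow> real) \<Rightarrow> bool" where
  "second_order_bound X G b \<longleftrightarrow>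
     (\<forall>x\<in>X. \<forall>z z'. norm z = 1 \<and> norm z' = 1 \<and>
        points_into X x z \<and> points_into X x z' \<and>
        (\<forall>\<^sub>F \<delta> in at_right (0::real). points_into X (x + \<delta> *\<^sub>R z') z) \<longrightarrow>
        Limsup (at_right (0::real))
          (\<lambda>\<delta>. ereal (\<bar>dir_deriv G z (x + \<delta> *\<^sub>R z') - dir_deriv G z x\<bar> / \<delta>))
        \<le> ereal (b x))"

definition condition_i :: "('a::real_normed_vector \<Rightarrow> real) \<Rightarrow> bool" where
  "condition_i g \<longleftrightarrow>
     (\<exists>K. K-lipschitz_on UNIV g) \<and> (\<forall>x. 0 \<le> g x) \<and> filterlim g at_top at_infinity"

definition condition_ii ::
    "nat \<Rightarrow> (nat \<Rightarrow> 'a::real_inner set) \<Rightarrow> (nat \<Rightarrow> 'a \<Rightarrow> real \<Rightarrow> 'a) \<Rightarrow>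
     real \<Rightarrow> real \<Rightarrow> ('a \<Rightarrow> real) \<Rightarrow> bool" where
  "condition_ii n0 X y C1 C2 g \<longleftrightarrow>
     (\<forall>n\<ge>n0.
        (\<forall>x\<in>X n. set_integrable lborel {0..} (\<lambda>t. g (y n x t))) \<and>
        has_continuous_gradient_on (fluid_cost (y n) g) (X n) \<and>
        second_order_bound (X n) (fluid_cost (y n) g) (\<lambda>x. C1 * g x + C2)) \<and>
     (\<forall>K. \<exists>r. \<forall>n\<ge>n0. \<forall>x\<in>X n. norm x \<ge> r \<longrightarrow> fluid_cost (y n) g x \<ge> K)"

end

theory Submission
  imports Defs "HOL-Real_Asymp.Real_Asymp"
begin

text \<open>
  The fluid cost \<open>G\<close> is a Lyapunov function for the chain, and this is the whole reason for
  the bound. Along the fluid limit \<open>G\<close> decreases at rate \<open>g\<close>, so its gradient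
  satisfies \<open>\<nabla>G(x) \<bullet> v(x) = - g(x)\<close> (\<open>gradient_drift_eq_neg_cost\<close>). On a segment of
  \<open>X\<close> the second-order bound says that the upper right Dini derivatives of the derivative of
  \<open>G\<close> along the segment are at most \<open>M\<close> in absolute value, where \<open>M\<close> bounds \<open>C1 * g + C2\<close>; that
  derivative is then \<open>M\<close>-Lipschitz, whence \<open>G(x') - G(x) \<le> \<nabla>G(x) \<bullet> (x' - x) + M |x' - x|\<^sup>2\<close>
  (\<open>second_order_increment_bound\<close>). Weighting this with the transition rates out of \<open>x\<close>, the
  first-order terms add up to \<open>\<nabla>G(x) \<bullet> v(x)\<close>, while the remainder is at most
  \<open>M * (R2\<^sup>2 / n) * (R1 * n) = R1 * R2\<^sup>2 * M\<close>, where \<open>M\<close> exceeds \<open>C1 * g(x)\<close> by a constant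
  since \<open>g\<close> is Lipschitz and the jumps have length at most \<open>R2\<close>. As soon as
  \<open>C1 * R1 * R2\<^sup>2 \<le> 1 / 2\<close>, the generator applied to \<open>G\<close> is at most \<open>E - g / 2\<close>, with \<open>E\<close>
  independent of \<open>n\<close>.

  It remains to pass from this drift inequality to the stationary expectation, although \<open>G\<close>
  is unbounded. The function \<open>k - min G k\<close> has finite support on the lattice, because \<open>G\<close>
  tends to infinity, so its generator has stationary mean zero; this only needs the
  global balance equations for single states (\<open>stationary_global_balance\<close>), which are the
  derivative at time zero of \<open>\<pi> P\<^sub>t = \<pi>\<close>. The generator applied to \<open>min G k\<close> is
  nonpositive where \<open>G \<ge> k\<close> and at most that of \<open>G\<close> where \<open>G < k\<close>; therefore \<open>g\<close> has
  stationary mean at most \<open>2 * E\<close> over \<open>{G < k}\<close>, and \<open>k\<close> tends to infinity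
  (\<open>stationary_foster_bound\<close>).
\<close>

section \<open>Stationary distributions and Lyapunov functions of continuous-time Markov chains\<close>

lemma trans_prob_sets:
  assumes "ctmc S \<nu> Pr Z" "x \<in> S" "y \<in> S" "0 \<le> t"
  shows "{\<omega> \<in> space (Pr x). Z t \<omega> = y} \<in> sets (Pr x)"
proof -
  have "Z t \<in> Pr x \<rightarrow>\<^sub>M count_space S"
    using assms by (auto simp: ctmc_def)
  then have "Z t -` {y} \<inter> space (Pr x) \<in> sets (Pr x)"
    using \<open>y \<in> S\<close> by (intro measurable_sets) auto
  then show ?thesis
    by (simp add: vimage_def Int_def conj_commute)
qed

lemma stay_prob_supermultiplicative:
  assumes ctmc: "ctmc S \<nu> Pr Z" and x: "x \<in> S" and "0 \<le> r" "0 \<le> t"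
  shows "trans_prob Pr Z r x x * trans_prob Pr Z t x x \<le> trans_prob Pr Z (r + t) x x"
proof -
  interpret prob_space "Pr x"
    using ctmc x by (auto simp: ctmc_def)
  have markov: "\<forall>T f. finite T \<and> T \<subseteq> {0..r} \<longrightarrow>
        measure (Pr x) {\<omega> \<in> space (Pr x).
            (\<forall>u\<in>T. Z u \<omega> = f u) \<and> Z r \<omega> = x \<and> Z (r + t) \<omega> = x}
        = measure (Pr x) {\<omega> \<in> space (Pr x). (\<forall>u\<in>T. Z u \<omega> = f u) \<and> Z r \<omega> = x}
            * trans_prob Pr Z t x x"
    using ctmc x assms(3,4) by (auto simp: ctmc_def)
  have "trans_prob Pr Z r x x * trans_prob Pr Z t x x
      = measure (Pr x) {\<omega> \<in> space (Pr x). Z r \<omega> = x \<and> Z (r + t) \<omega> = x}"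
    using markov[rule_format, of "{}"] by (simp add: trans_prob_def)
  also have "\<dots> \<le> trans_prob Pr Z (r + t) x x"
    unfolding trans_prob_def
    using trans_prob_sets[OF ctmc x x, of "r + t"] assms(3,4)
    by (intro finite_measure_mono) auto
  finally show ?thesis .
qed

lemma trans_prob_nonneg: "0 \<le> trans_prob Pr Z t x y"
  by (simp add: trans_prob_def)

lemma trans_prob_le_1:
  assumes "ctmc S \<nu> Pr Z" "x \<in> S"
  shows "trans_prob Pr Z t x y \<le> 1"
proof -
  interpret prob_space "Pr x"
    using assms by (auto simp: ctmc_def)
  show ?thesis
    by (simp add: trans_prob_def)
qed

text \<open>
  By the supermultiplicativity of the holding probabilities, \<open>1 - P\<^sub>t(x,x)\<close> is subadditive in
  \<open>t\<close>, so it lies below the line given by its slope at \<open>0\<close>. This provides the dominating function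
  for differentiating the stationarity equations.
\<close>

lemma leave_prob_le:
  assumes ctmc: "ctmc S \<nu> Pr Z" and x: "x \<in> S" and t: "0 < t"
  shows "1 - trans_prob Pr Z t x x \<le> exit_rate S \<nu> x * t"
proof -
  define p where "p t = trans_prob Pr Z t x x" for t
  have p01: "0 \<le> p u" "p u \<le> 1" for u
    by (simp_all add: p_def trans_prob_nonneg trans_prob_le_1[OF ctmc x])
  have subadd: "1 - p (r + u) \<le> (1 - p r) + (1 - p u)" if "0 \<le> r" "0 \<le> u" for r u
  proof -
    have "p r * p u \<le> p (r + u)"
      using stay_prob_supermultiplicative[OF ctmc x that] by (simp add: p_def)
    moreover have "0 \<le> (1 - p r) * (1 - p u)"
      using p01 by (intro mult_nonneg_nonneg) auto
    ultimately show ?thesis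
      by (simp add: algebra_simps)
  qed
  have iter: "1 - p (real (Suc m) * u) \<le> real (Suc m) * (1 - p u)" if "0 \<le> u" for m u
  proof (induction m)
    case (Suc m)
    have "1 - p (real (Suc (Suc m)) * u) = 1 - p (real (Suc m) * u + u)"
      by (simp add: algebra_simps)
    also have "\<dots> \<le> (1 - p (real (Suc m) * u)) + (1 - p u)"
      using that by (intro subadd) auto
    also have "\<dots> \<le> real (Suc (Suc m)) * (1 - p u)"
      using Suc by (simp add: algebra_simps)
    finally show ?case .
  qed simp
  have "((\<lambda>u. (1 - p u) / u) \<longlongrightarrow> exit_rate S \<nu> x) (at_right 0)"
    using ctmc x by (auto simp: ctmc_def p_def)
  moreover have "filterlim (\<lambda>m. t / real (Suc m)) (at_right 0) sequentially"
    using t by real_asymp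
  ultimately have "(\<lambda>m. (1 - p (t / real (Suc m))) / (t / real (Suc m))) \<longlonglongrightarrow> exit_rate S \<nu> x"
    by (rule filterlim_compose)
  then have "(\<lambda>m. (1 - p (t / real (Suc m))) / (t / real (Suc m)) * t) \<longlonglongrightarrow> exit_rate S \<nu> x * t"
    by (intro tendsto_mult tendsto_const)
  moreover have "1 - p t \<le> (1 - p (t / real (Suc m))) / (t / real (Suc m)) * t" for m
  proof -
    have "1 - p t \<le> real (Suc m) * (1 - p (t / real (Suc m)))"
      using iter[of "t / real (Suc m)" m] t by (simp del: of_nat_Suc)
    then show ?thesis
      using t by (simp del: of_nat_Suc add: mult.commute)
  qed
  ultimately show ?thesis
    unfolding p_def by (intro LIMSEQ_le_const) auto
qed

lemma ctmc_rate_nonneg: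
  assumes "ctmc S \<nu> Pr Z" "x \<in> S" "x' \<in> S" "x' \<noteq> x"
  shows "0 \<le> \<nu> x x'"
proof -
  have "((\<lambda>t. trans_prob Pr Z t x x' / t) \<longlongrightarrow> \<nu> x x') (at_right 0)"
    using assms by (auto simp: ctmc_def)
  moreover have "\<forall>\<^sub>F t in at_right 0. 0 \<le> trans_prob Pr Z t x x' / t"
    using eventually_at_right_less by eventually_elim (simp add: trans_prob_nonneg)
  ultimately show ?thesis
    by (intro tendsto_lowerbound) auto
qed

lemma trans_prob_le_leave_prob:
  assumes ctmc: "ctmc S \<nu> Pr Z" and x: "x \<in> S" "y \<in> S" "x \<noteq> y" and t: "0 \<le> t"
  shows "trans_prob Pr Z t x y \<le> 1 - trans_prob Pr Z t x x"
proof -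
  interpret prob_space "Pr x"
    using ctmc x by (auto simp: ctmc_def)
  have "trans_prob Pr Z t x y + trans_prob Pr Z t x x
      = prob ({\<omega> \<in> space (Pr x). Z t \<omega> = y} \<union> {\<omega> \<in> space (Pr x). Z t \<omega> = x})"
    unfolding trans_prob_def using x t
    by (intro finite_measure_Union[symmetric] trans_prob_sets[OF ctmc]) auto
  also have "\<dots> \<le> 1"
    by simp
  finally show ?thesis
    by simp
qed

text \<open>
  The generator matrix: off the diagonal the transition rates, on it minus the total rate out of
  the state (whatever the value of \<open>\<nu> x x\<close>).
\<close>

definition rate_matrix :: "'a set \<Rightarrow> ('a \<Rightarrow> 'a \<Rightarrow> real) \<Rightarrow> 'a \<Rightarrow> 'a \<Rightarrow> real" where
  "rate_matrix S \<nu> x y = (if x = y then - exit_rate S \<nu> x else \<nu> x y)"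

text \<open>
  The difference quotients of \<open>P\<^sub>t(x,y)\<close> at \<open>t = 0\<close> have stationary mean zero, are bounded by
  \<open>B\<close>, and converge to the generator matrix.
\<close>

lemma stationary_global_balance:
  assumes ctmc: "ctmc S \<nu> Pr Z" and stat: "stationary_distribution S Pr Z \<pi>"
    and B: "\<And>x. x \<in> S \<Longrightarrow> exit_rate S \<nu> x \<le> B" and y: "y \<in> S"
  shows "integrable (measure_pmf \<pi>) (\<lambda>x. rate_matrix S \<nu> x y)"
    and "(\<integral>x. rate_matrix S \<nu> x y \<partial>measure_pmf \<pi>) = 0"
proof -
  define q where "q t x = (trans_prob Pr Z t x y - indicator {y} x) / t" for t x
  have S: "AE x in measure_pmf \<pi>. x \<in> S"
    using stat by (auto simp: stationary_distribution_def AE_measure_pmf_iff)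
  have lim: "((\<lambda>t. q t x) \<longlongrightarrow> rate_matrix S \<nu> x y) (at_right 0)" if x: "x \<in> S" for x
  proof (cases "x = y")
    case True
    have "((\<lambda>t. - ((1 - trans_prob Pr Z t x x) / t)) \<longlongrightarrow> - exit_rate S \<nu> x) (at_right 0)"
      using ctmc x by (intro tendsto_minus) (auto simp: ctmc_def)
    then show ?thesis
      using True by (simp add: q_def rate_matrix_def minus_divide_left)
  next
    case False
    then show ?thesis
      using ctmc x y by (auto simp: q_def rate_matrix_def ctmc_def)
  qed
  have bound: "\<bar>q t x\<bar> \<le> B" if x: "x \<in> S" and t: "0 < t" for x t
  proof -
    have "\<bar>trans_prob Pr Z t x y - indicator {y} x\<bar> \<le> 1 - trans_prob Pr Z t x x"
      using trans_prob_le_leave_prob[OF ctmc x y, of t] t trans_prob_le_1[OF ctmc x, of t y]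
        trans_prob_nonneg[of Pr Z t x y]
      by (cases "x = y") auto
    also have "\<dots> \<le> exit_rate S \<nu> x * t"
      by (rule leave_prob_le[OF ctmc x t])
    also have "\<dots> \<le> B * t"
      using B[OF x] t by (intro mult_right_mono) auto
    finally show ?thesis
      using t by (simp add: q_def field_simps)
  qed
  have zero: "(\<integral>x. q t x \<partial>measure_pmf \<pi>) = 0" if t: "0 < t" for t
  proof -
    have "integrable (measure_pmf \<pi>) (\<lambda>x. trans_prob Pr Z t x y)"
      using S by (intro measure_pmf.integrable_const_bound[where B=1])
        (auto simp: trans_prob_nonneg trans_prob_le_1[OF ctmc])
    moreover have "(\<integral>x. trans_prob Pr Z t x y \<partial>measure_pmf \<pi>) = pmf \<pi> y"
      using stat y t by (auto simp: stationary_distribution_def)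
    moreover have "integrable (measure_pmf \<pi>) (indicator {y} :: 'a \<Rightarrow> real)"
      by (intro measure_pmf.integrable_const_bound[where B=1]) auto
    ultimately show ?thesis
      by (simp add: q_def pmf.rep_eq)
  qed
  have seq: "filterlim (\<lambda>m. 1 / real (Suc m)) (at_right 0) sequentially"
    by real_asymp
  have lim': "AE x in measure_pmf \<pi>. (\<lambda>m. q (1 / real (Suc m)) x) \<longlonglongrightarrow> rate_matrix S \<nu> x y"
    using S by eventually_elim (rule filterlim_compose[OF lim seq])
  have bd: "AE x in measure_pmf \<pi>. norm (q (1 / real (Suc m)) x) \<le> B" for m
    using S by eventually_elim (simp add: bound del: of_nat_Suc)
  show "integrable (measure_pmf \<pi>) (\<lambda>x. rate_matrix S \<nu> x y)"
    by (rule integrable_dominated_convergence[where w="\<lambda>_. B" and s="\<lambda>m. q (1 / real (Suc m))"])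
      (use lim' bd in auto)
  have "(\<lambda>m. \<integral>x. q (1 / real (Suc m)) x \<partial>measure_pmf \<pi>)
      \<longlonglongrightarrow> (\<integral>x. rate_matrix S \<nu> x y \<partial>measure_pmf \<pi>)"
    by (rule integral_dominated_convergence[where w="\<lambda>_. B"]) (use lim' bd in auto)
  moreover have "(\<integral>x. q (1 / real (Suc m)) x \<partial>measure_pmf \<pi>) = 0" for m
    by (rule zero) simp
  ultimately show "(\<integral>x. rate_matrix S \<nu> x y \<partial>measure_pmf \<pi>) = 0"
    by (simp add: LIMSEQ_const_iff)
qed

lemma exit_rate_eq_sum:
  assumes "finite {y \<in> S - {x}. \<nu> x y \<noteq> 0}"
  shows "exit_rate S \<nu> x = (\<Sum>y | y \<in> S - {x} \<and> \<nu> x y \<noteq> 0. \<nu> x y)"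
  unfolding exit_rate_def using assms
  by (subst infsum_cong_neutral[where T="{y \<in> S - {x}. \<nu> x y \<noteq> 0}" and g="\<nu> x"]) auto

text \<open>
  A Foster--Lyapunov bound. The function \<open>V\<close> may be unbounded and not integrable under \<open>\<pi>\<close>;
  that its sublevel sets are finite allows it to be truncated.
\<close>

lemma stationary_foster_bound:
  fixes V g :: "'a \<Rightarrow> real"
  assumes ctmc: "ctmc S \<nu> Pr Z" and stat: "stationary_distribution S Pr Z \<pi>"
    and B: "\<And>x. x \<in> S \<Longrightarrow> exit_rate S \<nu> x \<le> B"
    and nbrs: "\<And>x. x \<in> S \<Longrightarrow> finite {y \<in> S - {x}. \<nu> x y \<noteq> 0}"
    and sublevel: "\<And>k. finite {x \<in> S. V x < k}"
    and g: "\<And>x. x \<in> S \<Longrightarrow> 0 \<le> g x" and c: "0 \<le> c"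
    and drift: "\<And>x. x \<in> S \<Longrightarrow> (\<Sum>y | y \<in> S - {x} \<and> \<nu> x y \<noteq> 0. \<nu> x y * (V y - V x)) \<le> c - g x"
  shows "(\<integral>\<^sup>+x. ennreal (g x) \<partial>measure_pmf \<pi>) \<le> ennreal c"
proof -
  have S: "AE x in measure_pmf \<pi>. x \<in> S"
    using stat by (auto simp: stationary_distribution_def AE_measure_pmf_iff)
  have trunc: "(\<integral>\<^sup>+x. ennreal (g x) * indicator {x \<in> S. V x < k} x \<partial>measure_pmf \<pi>) \<le> ennreal c"
    for k
  proof -
    define F where "F = {x \<in> S. V x < k}"
    \<comment> \<open>The truncation \<open>min V k\<close> is replaced by the finitely supported \<open>k - min V k\<close>.\<close>
    define h where "h x = k - min (V x) k" for x
    have fin: "finite F"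
      using sublevel by (simp add: F_def)
    have h: "0 \<le> h x" "k - V x \<le> h x" for x
      by (auto simp: h_def)
    have hF: "x \<in> S \<Longrightarrow> x \<notin> F \<Longrightarrow> h x = 0" "x \<in> F \<Longrightarrow> h x = k - V x" for x
      by (auto simp: h_def F_def)
    have int: "integrable (measure_pmf \<pi>) (\<lambda>x. \<Sum>y\<in>F. h y * rate_matrix S \<nu> x y)"
      using stationary_global_balance(1)[OF ctmc stat B]
      by (intro Bochner_Integration.integrable_sum integrable_mult_right) (auto simp: F_def)
    have "(\<integral>x. (\<Sum>y\<in>F. h y * rate_matrix S \<nu> x y) \<partial>measure_pmf \<pi>)
        = (\<Sum>y\<in>F. h y * (\<integral>x. rate_matrix S \<nu> x y \<partial>measure_pmf \<pi>))"
      using stationary_global_balance(1)[OF ctmc stat B]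
      by (subst Bochner_Integration.integral_sum) (auto simp: F_def)
    also have "\<dots> = 0"
      using stationary_global_balance(2)[OF ctmc stat B] by (intro sum.neutral) (auto simp: F_def)
    finally have zero: "(\<integral>x. (\<Sum>y\<in>F. h y * rate_matrix S \<nu> x y) \<partial>measure_pmf \<pi>) = 0" .
    have gen: "(g x - c) * indicator F x \<le> (\<Sum>y\<in>F. h y * rate_matrix S \<nu> x y)"
      if x: "x \<in> S" for x
    \<comment> \<open>Outside \<open>F\<close> only nonnegative rates into \<open>F\<close> contribute. Inside, \<open>h = k - V\<close> at the state
      itself and \<open>h \<ge> k - V\<close> at its neighbours, so that the drift condition applies.\<close>
    proof (cases "x \<in> F")
      case False
      have "0 \<le> (\<Sum>y\<in>F. h y * rate_matrix S \<nu> x y)"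
        using False x h ctmc_rate_nonneg[OF ctmc x]
        by (intro sum_nonneg mult_nonneg_nonneg) (auto simp: rate_matrix_def F_def)
      then show ?thesis
        using False by simp
    next
      case True
      define N where "N = {y \<in> S - {x}. \<nu> x y \<noteq> 0}"
      have N: "finite N"
        using nbrs[OF x] by (simp add: N_def)
      have exit: "exit_rate S \<nu> x = (\<Sum>y\<in>N. \<nu> x y)"
        using exit_rate_eq_sum[of S x \<nu>] N by (simp add: N_def)
      have "g x - c \<le> (\<Sum>y\<in>N. \<nu> x y * (V x - V y))"
        using drift[OF x] by (simp add: N_def algebra_simps sum_subtractf)
      also have "\<dots> \<le> (\<Sum>y\<in>N. \<nu> x y * (h y - h x))"
      proof (rule sum_mono)
        fix y assume "y \<in> N"
        then have "0 \<le> \<nu> x y"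
          using ctmc_rate_nonneg[OF ctmc x] by (auto simp: N_def)
        moreover have "V x - V y \<le> h y - h x"
          using h(2)[of y] hF(2)[OF True] by simp
        ultimately show "\<nu> x y * (V x - V y) \<le> \<nu> x y * (h y - h x)"
          by (rule mult_left_mono[rotated])
      qed
      also have "\<dots> = (\<Sum>y\<in>N. h y * \<nu> x y) - h x * exit_rate S \<nu> x"
        by (simp add: exit algebra_simps sum_subtractf sum_distrib_left)
      also have "(\<Sum>y\<in>N. h y * \<nu> x y) = (\<Sum>y\<in>F - {x}. h y * \<nu> x y)"
        using N fin by (intro sum.mono_neutral_cong) (auto simp: N_def F_def h_def)
      also have "\<dots> - h x * exit_rate S \<nu> x = (\<Sum>y\<in>F. h y * rate_matrix S \<nu> x y)"
      proof -
        have "(\<Sum>y\<in>F - {x}. h y * \<nu> x y) = (\<Sum>y\<in>F - {x}. h y * rate_matrix S \<nu> x y)"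
          by (intro sum.cong) (auto simp: rate_matrix_def)
        then show ?thesis
          using sum.remove[OF fin True, of "\<lambda>y. h y * rate_matrix S \<nu> x y"]
          by (simp add: rate_matrix_def)
      qed
      finally show ?thesis
        using True by simp
    qed
    have intF: "integrable (measure_pmf \<pi>) (\<lambda>x. f x * indicator F x)" for f :: "'a \<Rightarrow> real"
    proof (rule measure_pmf.integrable_const_bound)
      show "AE x in measure_pmf \<pi>. norm (f x * indicator F x) \<le> (\<Sum>y\<in>F. \<bar>f y\<bar>)"
        using fin by (auto simp: indicator_def sum_nonneg intro!: AE_I2 member_le_sum)
    qed auto
    have "(\<integral>x. (g x - c) * indicator F x \<partial>measure_pmf \<pi>) \<le> 0"
      unfolding zero[symmetric]
      using S gen by (intro integral_mono_AE intF int) auto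
    then have "(\<integral>x. g x * indicator F x \<partial>measure_pmf \<pi>)
        \<le> c * measure (measure_pmf \<pi>) F"
      using intF[of g] intF[of "\<lambda>_. c"] by (simp add: left_diff_distrib)
    also have "\<dots> \<le> c"
      using c by (simp add: mult_left_le)
    finally have le: "(\<integral>x. g x * indicator F x \<partial>measure_pmf \<pi>) \<le> c" .
    have "(\<integral>\<^sup>+x. ennreal (g x) * indicator F x \<partial>measure_pmf \<pi>)
        = (\<integral>\<^sup>+x. ennreal (g x * indicator F x) \<partial>measure_pmf \<pi>)"
      by (intro nn_integral_cong) (auto simp: indicator_def)
    also have "\<dots> = ennreal (\<integral>x. g x * indicator F x \<partial>measure_pmf \<pi>)"
      using g by (intro nn_integral_eq_integral intF AE_I2) (auto simp: F_def indicator_def)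
    also have "\<dots> \<le> ennreal c"
      using le by (rule ennreal_leI)
    finally show ?thesis
      by (simp add: F_def)
  qed
  have mono: "incseq (\<lambda>k x. ennreal (g x) * indicator {x \<in> S. V x < real k} x)"
    by (intro incseq_SucI le_funI) (auto simp: indicator_def)
  have "(\<integral>\<^sup>+x. ennreal (g x) \<partial>measure_pmf \<pi>)
      \<le> (\<integral>\<^sup>+x. (SUP k. ennreal (g x) * indicator {x \<in> S. V x < real k} x) \<partial>measure_pmf \<pi>)"
  proof (rule nn_integral_mono_AE)
    show "AE x in measure_pmf \<pi>.
        ennreal (g x) \<le> (SUP k. ennreal (g x) * indicator {x \<in> S. V x < real k} x)"
      using S
    proof eventually_elim
      case (elim x)
      obtain k :: nat where "V x < real k"
        using reals_Archimedean2 by blast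
      then show ?case
        using elim by (intro SUP_upper2[of k]) auto
    qed
  qed
  also have "\<dots> = (SUP k. \<integral>\<^sup>+x. ennreal (g x) * indicator {x \<in> S. V x < real k} x \<partial>measure_pmf \<pi>)"
    using mono by (intro nn_integral_monotone_convergence_SUP) auto
  also have "\<dots> \<le> ennreal c"
    by (intro SUP_least trunc)
  finally show ?thesis .
qed

section \<open>The fluid cost along segments and along fluid limits\<close>

lemma has_real_derivative_along_curve:
  fixes G :: "'a::real_inner \<Rightarrow> real" and \<gamma> :: "real \<Rightarrow> 'a"
  assumes "(G has_derivative (\<lambda>h. d \<bullet> h)) (at (\<gamma> t) within X)"
    and "(\<gamma> has_vector_derivative u) (at t within T)" and "\<gamma> ` T \<subseteq> X"
  shows "((\<lambda>t. G (\<gamma> t)) has_real_derivative d \<bullet> u) (at t within T)"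
proof -
  have "(G has_derivative (\<lambda>h. d \<bullet> h)) (at (\<gamma> t) within \<gamma> ` T)"
    using assms(1,3) by (rule has_derivative_subset)
  from diff_chain_within[OF assms(2)[unfolded has_vector_derivative_def] this]
  show ?thesis
    by (simp add: has_field_derivative_def o_def mult_commute_abs)
qed

text \<open>
  A continuous function whose right Dini derivatives are bounded by \<open>M\<close> in absolute value is
  \<open>M\<close>-Lipschitz. The last point at which the increment from \<open>a\<close> obeys the bound with slope
  \<open>M + e\<close> cannot lie before \<open>b\<close>.
\<close>

lemma right_dini_bound_imp_increment_bound:
  fixes f :: "real \<Rightarrow> real"
  assumes "a \<le> b" and cont: "continuous_on {a..b} f"
    and dini: "\<And>t. a \<le> t \<Longrightarrow> t < b \<Longrightarrow>
      Limsup (at_right 0) (\<lambda>\<delta>. ereal (\<bar>f (t + \<delta>) - f t\<bar> / \<delta>)) \<le> ereal M"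
  shows "\<bar>f b - f a\<bar> \<le> M * (b - a)"
proof -
  have "\<bar>f b - f a\<bar> \<le> (M + e) * (b - a)" if e: "0 < e" for e
  proof -
    define A where "A = {t \<in> {a..b}. \<bar>f t - f a\<bar> \<le> (M + e) * (t - a)}"
    have "closed A"
      unfolding A_def by (intro continuous_on_closed_Collect_le continuous_intros cont closed_atLeastAtMost)
    moreover have "a \<in> A"
      using \<open>a \<le> b\<close> by (simp add: A_def)
    moreover have bdd: "bdd_above A"
      by (rule bdd_aboveI[of _ b]) (simp add: A_def)
    ultimately have sup: "Sup A \<in> A"
      by (intro closed_contains_Sup) auto
    have "Sup A = b"
    proof (rule ccontr)
      assume "Sup A \<noteq> b"
      define t where "t = Sup A"
      with sup \<open>Sup A \<noteq> b\<close> have t: "a \<le> t" "t < b" "\<bar>f t - f a\<bar> \<le> (M + e) * (t - a)"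
        by (auto simp: A_def)
      have "Limsup (at_right 0) (\<lambda>\<delta>. ereal (\<bar>f (t + \<delta>) - f t\<bar> / \<delta>)) < ereal (M + e)"
        using dini[OF t(1,2)] e by (rule_tac le_less_trans) auto
      then have "\<forall>\<^sub>F \<delta> in at_right 0. ereal (\<bar>f (t + \<delta>) - f t\<bar> / \<delta>) < ereal (M + e)"
        by (rule Limsup_lessD)
      moreover have "\<forall>\<^sub>F \<delta> in at_right 0. \<delta> < b - t"
        using t by (intro eventually_at_rightI[of 0 "b - t"]) auto
      moreover note eventually_at_right_less[of "0::real"]
      ultimately have "\<forall>\<^sub>F \<delta> in at_right (0::real). 0 < \<delta> \<and> t + \<delta> \<in> A"
      proof eventually_elim
        case (elim \<delta>)
        then have "\<bar>f (t + \<delta>) - f t\<bar> \<le> (M + e) * \<delta>"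
          by (simp add: field_simps)
        then show ?case
          using elim t by (auto simp: A_def algebra_simps)
      qed
      then obtain \<delta> where "0 < \<delta>" "t + \<delta> \<in> A"
        using eventually_happens by force
      then show False
        using cSup_upper[OF _ bdd] by (fastforce simp: t_def)
    qed
    then show ?thesis
      using sup by (simp add: A_def)
  qed
  moreover have "((\<lambda>e. (M + e) * (b - a)) \<longlongrightarrow> M * (b - a)) (at_right 0)"
    by (auto intro!: tendsto_eq_intros)
  ultimately show ?thesis
    using eventually_at_right_less[of "0::real"]
    by (intro tendsto_lowerbound) (auto elim: eventually_mono)
qed

text \<open>
  Only the case in which both directions of the second-order bound equal that of \<open>x' - x\<close> is used.
  From every point of the segment other than \<open>x'\<close> this direction points into \<open>X\<close>, so that the
  bound applies there even if the segment runs along the boundary.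
\<close>

lemma second_order_increment_bound:
  fixes G :: "'a::real_inner \<Rightarrow> real"
  assumes X: "convex X" and x: "x \<in> X" "x' \<in> X"
    and D: "continuous_on X D" "\<And>w. w \<in> X \<Longrightarrow> (G has_derivative (\<lambda>h. D w \<bullet> h)) (at w within X)"
    and bound: "second_order_bound X G b"
    and M: "\<And>w. w \<in> closed_segment x x' \<Longrightarrow> b w \<le> M"
  shows "G x' - G x \<le> D x \<bullet> (x' - x) + M * (norm (x' - x))\<^sup>2"
proof (cases "x' = x")
  case False
  define l where "l = norm (x' - x)"
  define u where "u = (x' - x) /\<^sub>R l"
  define \<gamma> where "\<gamma> t = x + t *\<^sub>R u" for t
  have l: "0 < l" and u: "norm u = 1"
    using False by (auto simp: l_def u_def)
  have end_pts: "\<gamma> 0 = x" "\<gamma> l = x'"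
    using l by (simp_all add: \<gamma>_def u_def)
  have seg: "\<gamma> t \<in> closed_segment x x'" if "t \<in> {0..l}" for t
  proof -
    have "\<gamma> t = (1 - t / l) *\<^sub>R x + (t / l) *\<^sub>R x'"
      by (simp add: \<gamma>_def u_def algebra_simps divide_inverse)
    moreover have "0 \<le> t / l" "t / l \<le> 1"
      using that l by auto
    ultimately show ?thesis
      unfolding in_segment by blast
  qed
  have \<gamma>X: "\<gamma> t \<in> X" if "t \<in> {0..l}" for t
    using seg[OF that] closed_segment_subset[OF x X] by blast
  have \<gamma>_add: "\<gamma> t + \<delta> *\<^sub>R u = \<gamma> (t + \<delta>)" for t \<delta>
    by (simp add: \<gamma>_def algebra_simps)
  have small: "\<forall>\<^sub>F \<delta> in at_right 0. t + \<delta> \<in> {t<..<l}" if "t < l" for t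
    using that by (intro eventually_at_rightI[of 0 "l - t"]) auto
  have into: "points_into X (\<gamma> t) u" if "0 \<le> t" "t < l" for t
    unfolding points_into_def \<gamma>_add
    using small[OF that(2)] by eventually_elim (use that in \<open>auto intro: \<gamma>X\<close>)
  define f where "f t = D (\<gamma> t) \<bullet> u" for t
  have \<gamma>_deriv: "(\<gamma> has_vector_derivative u) (at t within T)" for t T
    unfolding \<gamma>_def by (auto intro!: derivative_eq_intros)
  have G_deriv: "((\<lambda>t. G (\<gamma> t)) has_real_derivative f t) (at t within {0..l})" if "t \<in> {0..l}" for t
    unfolding f_def using \<gamma>X that
    by (intro has_real_derivative_along_curve[OF D(2) \<gamma>_deriv]) auto
  have dir: "dir_deriv G u (\<gamma> t) = f t" if t: "0 \<le> t" "t < l" for t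
  proof -
    have "((\<lambda>s. G (\<gamma> s)) has_real_derivative f t) (at t within {t..l})"
      using t by (intro DERIV_subset[OF G_deriv]) auto
    then have "((\<lambda>s. G (\<gamma> s)) has_real_derivative f t) (at_right t)"
      using t by (simp add: at_within_Icc_at_right)
    then have "((\<lambda>s. (G (\<gamma> s) - G (\<gamma> t)) / (s - t)) \<longlongrightarrow> f t) (at_right t)"
      by (simp add: has_field_derivative_iff)
    then have "((\<lambda>\<delta>. (G (\<gamma> (t + \<delta>)) - G (\<gamma> t)) / \<delta>) \<longlongrightarrow> f t) (at_right 0)"
      by (subst (asm) at_right_to_0) (simp add: filterlim_filtermap add.commute)
    then show ?thesis
      unfolding dir_deriv_def \<gamma>_add by (intro tendsto_Lim) auto
  qed
  have f_cont: "continuous_on {0..l} f"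
    unfolding f_def
    using \<gamma>_deriv
    by (intro continuous_intros continuous_on_compose2[OF D(1)])
      (auto simp: \<gamma>X continuous_on_eq_continuous_within intro: has_vector_derivative_continuous)
  have dini: "Limsup (at_right 0) (\<lambda>\<delta>. ereal (\<bar>f (t + \<delta>) - f t\<bar> / \<delta>)) \<le> ereal M"
    if t: "0 \<le> t" "t < l" for t
  proof -
    have "Limsup (at_right 0) (\<lambda>\<delta>. ereal (\<bar>f (t + \<delta>) - f t\<bar> / \<delta>))
        = Limsup (at_right 0)
            (\<lambda>\<delta>. ereal (\<bar>dir_deriv G u (\<gamma> t + \<delta> *\<^sub>R u) - dir_deriv G u (\<gamma> t)\<bar> / \<delta>))"
      using small[OF t(2)] t
      by (intro Limsup_eq) (auto elim!: eventually_mono simp: dir \<gamma>_add)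
    also have "\<dots> \<le> ereal (b (\<gamma> t))"
    proof -
      have "\<forall>\<^sub>F \<delta> in at_right 0. points_into X (\<gamma> t + \<delta> *\<^sub>R u) u"
        unfolding \<gamma>_add using small[OF t(2)] by eventually_elim (use t in \<open>auto intro: into\<close>)
      then show ?thesis
        using bound \<gamma>X[of t] into[OF t] t u unfolding second_order_bound_def by force
    qed
    also have "\<dots> \<le> ereal M"
      using M seg t by simp
    finally show ?thesis .
  qed
  \<comment> \<open>The mean value theorem for \<open>G\<close> along the segment, then the Lipschitz bound for its
    derivative \<open>f\<close>.\<close>
  obtain \<xi> where \<xi>: "0 < \<xi>" "\<xi> < l" "G (\<gamma> l) - G (\<gamma> 0) = (l - 0) * f \<xi>"
  proof -
    have "\<exists>\<xi>\<in>{0<..<l}. G (\<gamma> l) - G (\<gamma> 0) = (\<lambda>h. f \<xi> * h) (l - 0)"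
      using G_deriv by (intro mvt_simple l) (simp add: has_field_derivative_def)
    then show ?thesis
      by (auto simp: mult.commute intro: that)
  qed
  have "\<bar>f \<xi> - f 0\<bar> \<le> M * (\<xi> - 0)"
    using \<xi> by (intro right_dini_bound_imp_increment_bound continuous_on_subset[OF f_cont] dini) auto
  moreover have "0 \<le> M"
    using calculation \<xi>(1) by (smt (verit) mult_neg_pos)
  ultimately have "f \<xi> \<le> f 0 + M * l"
    using \<xi> mult_left_mono[of \<xi> l M] by simp
  then have "l * f \<xi> \<le> l * (f 0 + M * l)"
    using l by (intro mult_left_mono) auto
  moreover have "l * f 0 = D x \<bullet> (x' - x)"
    using l by (simp add: f_def end_pts u_def)
  ultimately show ?thesis
    using \<xi>(3) unfolding end_pts l_def[symmetric] by (simp add: algebra_simps power2_eq_square)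
qed simp

text \<open>
  Both sides are the right derivative at time \<open>0\<close> of the fluid cost along the fluid limit from
  \<open>x\<close>: on the left by the chain rule, on the right because the flow property, which holds by
  uniqueness, makes the cost from \<open>y x r\<close> the cost from \<open>x\<close> minus that incurred up to time \<open>r\<close>.
\<close>

lemma gradient_drift_eq_neg_cost:
  fixes g :: "'a::{real_inner,second_countable_topology} \<Rightarrow> real"
  assumes dfl: "\<And>x. x \<in> X \<Longrightarrow> is_DFL X v x (y x)" and x: "x \<in> X"
    and cont: "continuous_on UNIV g"
    and int: "\<And>x. x \<in> X \<Longrightarrow> set_integrable lborel {0..} (\<lambda>t. g (y x t))"
    and D: "(fluid_cost y g has_derivative (\<lambda>h. d \<bullet> h)) (at x within X)"
  shows "d \<bullet> v x = - g x"
proof -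
  have sol: "ode_solution X v x (y x)"
    using dfl[OF x] by (simp add: is_DFL_def)
  then have y0: "y x 0 = x" and yX: "\<And>t. 0 \<le> t \<Longrightarrow> y x t \<in> X"
    and yd: "\<And>t. 0 \<le> t \<Longrightarrow> (y x has_vector_derivative v (y x t)) (at t within {0..})"
    by (auto simp: ode_solution_def)
  have shift: "y (y x r) t = y x (r + t)" if "0 \<le> r" "0 \<le> t" for r t
  proof -
    have "ode_solution X v (y x r) (\<lambda>t. y x (r + t))"
      unfolding ode_solution_def
    proof (intro conjI allI impI)
      fix t :: real assume t: "0 \<le> t"
      show "y x (r + t) \<in> X"
        using t that by (intro yX) auto
      have "(y x has_vector_derivative v (y x (r + t))) (at (r + t) within (+) r ` {0..})"
        using t that by (intro has_vector_derivative_within_subset[OF yd]) auto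
      moreover have "((+) r has_vector_derivative 1) (at t within {0..})"
        by (auto intro!: derivative_eq_intros)
      ultimately show "((\<lambda>t. y x (r + t)) has_vector_derivative v (y x (r + t))) (at t within {0..})"
        using vector_diff_chain_within[of "(+) r" 1 t "{0..}" "y x"] by (simp add: o_def)
    qed simp
    then show ?thesis
      using dfl[OF yX[OF that(1)]] that unfolding is_DFL_def by auto
  qed
  define c where "c t = g (y x t)" for t
  have y_cont: "continuous_on {0..} (y x)"
    using yd by (auto simp: continuous_on_eq_continuous_within intro: has_vector_derivative_continuous)
  have c_cont: "continuous_on {0..} c"
    unfolding c_def by (intro continuous_on_compose2[OF cont y_cont]) auto
  have cost: "fluid_cost y g (y x r) = fluid_cost y g x - integral {0..r} c" if r: "0 \<le> r" for r
  proof -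
    have c_int: "set_integrable lborel {0..} c"
      using int[OF x] by (simp add: c_def[abs_def])
    have "fluid_cost y g (y x r) = (LBINT t:{0..}. c (r + t))"
      unfolding fluid_cost_def c_def using r
      by (intro set_lebesgue_integral_cong) (auto simp: shift)
    also have "\<dots> = (LBINT t:{r..}. c t)"
      unfolding set_lebesgue_integral_def
      by (subst (2) lborel_integral_real_affine[of 1 _ r])
        (auto simp: indicator_def intro!: Bochner_Integration.integral_cong)
    finally have tail: "fluid_cost y g (y x r) = (LBINT t:{r..}. c t)" .
    have "fluid_cost y g x = (LBINT t:{0..r} \<union> {r..}. c t)"
    proof -
      have "{0..} = {0..r} \<union> {r..}"
        using r by auto
      then show ?thesis
        by (simp only: fluid_cost_def c_def)
    qed
    also have "\<dots> = (LBINT t:{0..r}. c t) + (LBINT t:{r..}. c t)"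
    proof (rule set_integral_Un_AE)
      show "AE t in lborel. \<not> (t \<in> {0..r} \<and> t \<in> {r..})"
        using AE_lborel_singleton[of r] by eventually_elim auto
    qed (use r in \<open>auto intro: set_integrable_subset[OF c_int]\<close>)
    also have "(LBINT t:{0..r}. c t) = integral {0..r} c"
      using r by (intro set_borel_integral_eq_integral(2) set_integrable_subset[OF c_int]) auto
    finally show ?thesis
      using tail by simp
  qed
  have "((\<lambda>r. fluid_cost y g (y x r)) has_real_derivative d \<bullet> v x) (at 0 within {0..})"
    using D yd[of 0] yX by (intro has_real_derivative_along_curve) (auto simp: y0)
  then have "((\<lambda>r. fluid_cost y g (y x r)) has_real_derivative d \<bullet> v x) (at 0 within {0..1})"
    by (rule DERIV_subset) auto
  moreover have "((\<lambda>r. fluid_cost y g (y x r)) has_real_derivative - g x) (at 0 within {0..1})"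
  proof -
    have "((\<lambda>r. integral {0..r} c) has_real_derivative c 0) (at 0 within {0..1})"
      by (intro integral_has_real_derivative continuous_on_subset[OF c_cont]) auto
    then have "((\<lambda>r. fluid_cost y g x - integral {0..r} c) has_real_derivative 0 - c 0)
        (at 0 within {0..1})"
      by (intro DERIV_diff DERIV_const)
    then have "((\<lambda>r. fluid_cost y g (y x r)) has_real_derivative 0 - c 0) (at 0 within {0..1})"
      by (rule has_field_derivative_transform_within[where d=1]) (auto simp: cost)
    then show ?thesis
      by (simp add: c_def y0)
  qed
  ultimately show ?thesis
    by (rule has_field_derivative_unique) (simp add: at_within_Icc_at_right)
qed

section \<open>The drift of the fluid cost under the chain\<close>

lemma finite_lattice_states_bounded:
  fixes X :: "(real^'i) set"
  assumes "0 < n"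
  shows "finite {x \<in> lattice_states n s X. norm x \<le> r}"
proof -
  define f :: "real^'i \<Rightarrow> real^'i" where "f k = k /\<^sub>R sqrt (real n) + s" for k
  define R where "R = sqrt (real n) * (r + norm s)"
  define K where "K = {k :: real^'i. \<forall>i. k $ i \<in> {j \<in> \<int>. \<bar>j\<bar> \<le> R}}"
  have "finite {j \<in> \<int>. \<bar>j\<bar> \<le> R}"
    by (rule finite_abs_int_segment)
  then have "finite (UNIV \<rightarrow>\<^sub>E {j \<in> \<int>. \<bar>j\<bar> \<le> R} :: ('i \<Rightarrow> real) set)"
    by (intro finite_PiE) auto
  moreover have "K \<subseteq> vec_lambda ` (UNIV \<rightarrow>\<^sub>E {j \<in> \<int>. \<bar>j\<bar> \<le> R})"
  proof
    fix k assume "k \<in> K"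
    then have "vec_nth k \<in> UNIV \<rightarrow>\<^sub>E {j \<in> \<int>. \<bar>j\<bar> \<le> R}"
      by (auto simp: K_def)
    then show "k \<in> vec_lambda ` (UNIV \<rightarrow>\<^sub>E {j \<in> \<int>. \<bar>j\<bar> \<le> R})"
      by (intro image_eqI[of _ _ "vec_nth k"]) auto
  qed
  ultimately have "finite K"
    by (rule finite_surj)
  moreover have "{x \<in> lattice_states n s X. norm x \<le> r} \<subseteq> f ` K"
  proof
    fix x assume "x \<in> {x \<in> lattice_states n s X. norm x \<le> r}"
    then obtain k where k: "x = f k" "\<forall>i. k $ i \<in> \<int>" "norm x \<le> r"
      by (auto simp: lattice_states_def f_def)
    have "\<bar>k $ i\<bar> \<le> R" for i
    proof -
      have "k = sqrt (real n) *\<^sub>R (x - s)"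
        using k(1) assms by (simp add: f_def)
      then have "norm k = sqrt (real n) * norm (x - s)"
        by simp
      also have "\<dots> \<le> R"
        unfolding R_def using norm_triangle_ineq4[of x s] k(3) by (intro mult_left_mono) auto
      finally show ?thesis
        using component_le_norm_cart[of k i] by linarith
    qed
    then show "x \<in> f ` K"
      using k by (auto simp: K_def)
  qed
  ultimately show ?thesis
    by (rule finite_surj)
qed

text \<open>
  The generator applied to \<open>G\<close> exceeds the gradient paired with the drift vector by at most a
  second-order remainder; \<open>\<rho>\<close> bounds the jump lengths from \<open>x\<close>.
\<close>

lemma generator_le_gradient_term:
  fixes G :: "'a::euclidean_space \<Rightarrow> real"
  assumes ctmc: "ctmc S \<nu> Pr Z" and x: "x \<in> S" and X: "convex X" "S \<subseteq> X"
    and D: "continuous_on X D" "\<And>w. w \<in> X \<Longrightarrow> (G has_derivative (\<lambda>h. D w \<bullet> h)) (at w within X)"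
    and bound: "second_order_bound X G b"
    and M: "\<And>w. dist x w \<le> \<rho> \<Longrightarrow> b w \<le> M" and "0 \<le> M"
    and nbrs: "finite {y \<in> S - {x}. \<nu> x y \<noteq> 0}"
    and jump: "\<And>y. y \<in> S - {x} \<Longrightarrow> \<nu> x y \<noteq> 0 \<Longrightarrow> norm (y - x) \<le> \<rho>"
  shows "(\<Sum>y | y \<in> S - {x} \<and> \<nu> x y \<noteq> 0. \<nu> x y * (G y - G x))
    \<le> D x \<bullet> (\<Sum>y | y \<in> S - {x} \<and> \<nu> x y \<noteq> 0. \<nu> x y *\<^sub>R (y - x)) + M * \<rho>\<^sup>2 * exit_rate S \<nu> x"
proof -
  define N where "N = {y \<in> S - {x}. \<nu> x y \<noteq> 0}"
  have "\<nu> x y * (G y - G x) \<le> \<nu> x y * (D x \<bullet> (y - x) + M * \<rho>\<^sup>2)" if y: "y \<in> N" for y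
  proof -
    have "G y - G x \<le> D x \<bullet> (y - x) + M * (norm (y - x))\<^sup>2"
    proof (rule second_order_increment_bound[OF X(1) _ _ D bound])
      fix w assume "w \<in> closed_segment x y"
      then have "dist x w \<le> dist x y"
        using dist_in_closed_segment[of w x y] by (simp add: dist_commute)
      also have "\<dots> \<le> \<rho>"
        using jump[of y] y by (simp add: N_def dist_norm norm_minus_commute)
      finally show "b w \<le> M"
        by (rule M)
    qed (use x y X in \<open>auto simp: N_def\<close>)
    also have "M * (norm (y - x))\<^sup>2 \<le> M * \<rho>\<^sup>2"
      using jump y \<open>0 \<le> M\<close> by (intro mult_left_mono power_mono) (auto simp: N_def)
    finally show ?thesis
      using ctmc_rate_nonneg[OF ctmc x] y by (intro mult_left_mono) (auto simp: N_def)
  qed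
  then have "(\<Sum>y\<in>N. \<nu> x y * (G y - G x)) \<le> (\<Sum>y\<in>N. \<nu> x y * (D x \<bullet> (y - x) + M * \<rho>\<^sup>2))"
    by (rule sum_mono)
  also have "\<dots> = D x \<bullet> (\<Sum>y\<in>N. \<nu> x y *\<^sub>R (y - x)) + M * \<rho>\<^sup>2 * (\<Sum>y\<in>N. \<nu> x y)"
    by (simp add: distrib_left sum.distrib inner_sum_right sum_distrib_left sum_distrib_right mult_ac)
  also have "(\<Sum>y\<in>N. \<nu> x y) = exit_rate S \<nu> x"
    using nbrs by (simp add: exit_rate_eq_sum N_def)
  finally show ?thesis
    by (simp add: N_def)
qed

theorem theorem5:
  fixes n0 :: nat
    and R1 R2 :: real
    and X :: "nat \<Rightarrow> (real^'i) set"
    and s :: "nat \<Rightarrow> real^'i"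
    and S :: "nat \<Rightarrow> (real^'i) set"
    and \<nu> :: "nat \<Rightarrow> real^'i \<Rightarrow> real^'i \<Rightarrow> real"
    and Pr :: "nat \<Rightarrow> real^'i \<Rightarrow> 'w measure"
    and Z :: "nat \<Rightarrow> real \<Rightarrow> 'w \<Rightarrow> real^'i"
    and \<pi> :: "nat \<Rightarrow> (real^'i) pmf"
    and v :: "nat \<Rightarrow> real^'i \<Rightarrow> real^'i"
    and y :: "nat \<Rightarrow> real^'i \<Rightarrow> real \<Rightarrow> real^'i"
  assumes "n0 > 0" and "R1 > 0" and "R2 > 0"
    and "\<And>n. n \<ge> n0 \<Longrightarrow> convex (X n) \<and> closed (X n) \<and> 0 \<in> X n"
    and "\<And>n. n \<ge> n0 \<Longrightarrow> S n = lattice_states n (s n) (X n)"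
    and "\<And>n. n \<ge> n0 \<Longrightarrow> ctmc (S n) (\<nu> n) (Pr n) (Z n)"
    and "\<And>n. n \<ge> n0 \<Longrightarrow> ctmc_irreducible (S n) (Pr n) (Z n)"
    and "\<And>n. n \<ge> n0 \<Longrightarrow> ctmc_positive_recurrent (S n) (\<nu> n) (Pr n) (Z n)"
    and "\<And>n. n \<ge> n0 \<Longrightarrow> stationary_distribution (S n) (Pr n) (Z n) (\<pi> n)"
    and "\<And>n x. n \<ge> n0 \<Longrightarrow> x \<in> S n \<Longrightarrow> exit_rate (S n) (\<nu> n) x \<le> R1 * real n"
    and "\<And>n x x'. n \<ge> n0 \<Longrightarrow> x \<in> S n \<Longrightarrow> x' \<in> S n \<Longrightarrow> x' \<noteq> x \<Longrightarrow> \<nu> n x x' > 0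
           \<Longrightarrow> norm (x' - x) \<le> R2 / sqrt (real n)"
    and "\<exists>K. \<forall>n\<ge>n0. K-lipschitz_on (X n) (v n)"
    and "\<And>n x. n \<ge> n0 \<Longrightarrow> x \<in> S n
           \<Longrightarrow> v n x = (\<Sum>\<^sub>\<infinity>x'\<in>S n. \<nu> n x x' *\<^sub>R (x' - x))"
    and "\<And>n x. n \<ge> n0 \<Longrightarrow> x \<in> X n \<Longrightarrow> is_DFL (X n) (v n) x (y n x)"
    and "\<And>C1. C1 > 0 \<Longrightarrow> \<exists>g C2. C2 > 0 \<and> condition_i g \<and> condition_ii n0 X y C1 C2 g"
  shows "\<exists>c>0. \<forall>C1 C2 g. 0 < C1 \<and> C1 \<le> c \<and> C2 > 0 \<and> condition_i g \<and> condition_ii n0 X y C1 C2 g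
           \<longrightarrow> (SUP n\<in>{n0..}. \<integral>\<^sup>+x. ennreal (g x) \<partial>measure_pmf (\<pi> n)) < \<infinity>"
proof -
  note params = assms(1-3) and domain = assms(4) and states = assms(5) and chain = assms(6)
    and stat = assms(9) and exit = assms(10) and jump = assms(11) and drift = assms(13)
    and dfl = assms(14)
  \<comment> \<open>This value of \<open>c\<close> lets the second-order remainder consume at most half of the drift \<open>- g\<close>.\<close>
  define c where "c = 1 / (2 * (R1 * R2\<^sup>2))"
  have "0 < c"
    using params by (simp add: c_def)
  moreover have "(SUP n\<in>{n0..}. \<integral>\<^sup>+x. ennreal (g x) \<partial>measure_pmf (\<pi> n)) < \<infinity>"
    if C1: "0 < C1" "C1 \<le> c" and C2: "0 < C2" and i: "condition_i g"
      and ii: "condition_ii n0 X y C1 C2 g" for C1 C2 g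
  proof -
    obtain K where K: "K-lipschitz_on UNIV g" and g: "\<And>x. 0 \<le> g x"
      using i by (auto simp: condition_i_def)
    have K0: "0 \<le> K"
      using K by (rule lipschitz_on_nonneg)
    \<comment> \<open>The part of the remainder that does not depend on the state.\<close>
    define E where "E = R1 * R2\<^sup>2 * (C1 * K * R2 + C2)"
    have E: "0 \<le> E"
      using params C1 C2 K0 by (simp add: E_def)
    have "(\<integral>\<^sup>+x. ennreal (g x) \<partial>measure_pmf (\<pi> n)) \<le> ennreal (2 * E)" if n: "n0 \<le> n" for n
    proof -
      define G where "G = fluid_cost (y n) g"
      define \<rho> where "\<rho> = R2 / sqrt (real n)"
      have n0: "0 < n" "1 \<le> sqrt (real n)"
        using n params by auto
      have \<rho>: "\<rho> \<le> R2" "\<rho>\<^sup>2 = R2\<^sup>2 / real n"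
        using n0 params by (auto simp: \<rho>_def divide_le_eq power_divide mult_le_cancel_left1)
      have SX: "S n \<subseteq> X n" and fin: "finite {x \<in> S n. norm x \<le> r}" for r
        using states[OF n] finite_lattice_states_bounded[OF n0(1), of "s n" "X n" r]
        by (auto simp: lattice_states_def)
      obtain D where D: "continuous_on (X n) D"
        "\<And>x. x \<in> X n \<Longrightarrow> (G has_derivative (\<lambda>h. D x \<bullet> h)) (at x within X n)"
        using ii n by (auto simp: condition_ii_def has_continuous_gradient_on_def G_def)
      have bound: "second_order_bound (X n) G (\<lambda>x. C1 * g x + C2)"
        and int: "\<And>x. x \<in> X n \<Longrightarrow> set_integrable lborel {0..} (\<lambda>t. g (y n x t))"
        using ii n by (auto simp: condition_ii_def G_def)
      have jump': "norm (x' - x) \<le> \<rho>" if "x \<in> S n" "x' \<in> S n - {x}" "\<nu> n x x' \<noteq> 0" for x x'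
      proof -
        have "0 < \<nu> n x x'"
          using ctmc_rate_nonneg[OF chain[OF n], of x x'] that by auto
        then show ?thesis
          using jump[OF n] that by (auto simp: \<rho>_def)
      qed
      have nbrs: "finite {x' \<in> S n - {x}. \<nu> n x x' \<noteq> 0}" if x: "x \<in> S n" for x
      proof (rule finite_subset[OF _ fin[of "norm x + \<rho>"]])
        show "{x' \<in> S n - {x}. \<nu> n x x' \<noteq> 0} \<subseteq> {x' \<in> S n. norm x' \<le> norm x + \<rho>}"
        proof
          fix x' assume x': "x' \<in> {x' \<in> S n - {x}. \<nu> n x x' \<noteq> 0}"
          then have "norm x' \<le> norm x + \<rho>"
            using jump'[OF x, of x'] norm_triangle_sub[of x' x] by auto
          then show "x' \<in> {x' \<in> S n. norm x' \<le> norm x + \<rho>}"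
            using x' by auto
        qed
      qed
      have sublevel: "finite {x \<in> S n. 2 * G x < k}" for k
      proof -
        obtain r where r: "\<And>x. x \<in> X n \<Longrightarrow> r \<le> norm x \<Longrightarrow> k / 2 \<le> G x"
          using ii n unfolding condition_ii_def G_def by meson
        have "{x \<in> S n. 2 * G x < k} \<subseteq> {x \<in> S n. norm x \<le> r}"
        proof
          fix x assume x: "x \<in> {x \<in> S n. 2 * G x < k}"
          then have "\<not> r \<le> norm x"
            using r[of x] SX by auto
          then show "x \<in> {x \<in> S n. norm x \<le> r}"
            using x by auto
        qed
        then show ?thesis
          by (rule finite_subset[OF _ fin])
      qed
      \<comment> \<open>The Lyapunov function is \<open>2 * G\<close>, so that the drift bound holds with \<open>g\<close> itself.\<close>
      have lyapunov: "(\<Sum>x' | x' \<in> S n - {x} \<and> \<nu> n x x' \<noteq> 0. \<nu> n x x' * (2 * G x' - 2 * G x))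
          \<le> 2 * E - g x" if x: "x \<in> S n" for x
      proof -
        let ?N = "{x' \<in> S n - {x}. \<nu> n x x' \<noteq> 0}"
        define M where "M = C1 * g x + (C1 * K * R2 + C2)"
        have M0: "0 \<le> M"
          using C1 C2 g K0 params by (simp add: M_def)
        have M: "C1 * g w + C2 \<le> M" if "dist x w \<le> \<rho>" for w
        proof -
          have "\<bar>g x - g w\<bar> \<le> K * dist x w"
            using lipschitz_onD[OF K, of x w] by (simp add: dist_real_def)
          also have "\<dots> \<le> K * R2"
            using that \<rho>(1) K0 by (intro mult_left_mono) auto
          finally have "C1 * g w \<le> C1 * (g x + K * R2)"
            using C1 by (intro mult_left_mono) auto
          then show ?thesis
            by (simp add: M_def algebra_simps)
        qed
        have v: "v n x = (\<Sum>x'\<in>?N. \<nu> n x x' *\<^sub>R (x' - x))"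
          unfolding drift[OF n x] using nbrs[OF x]
          by (subst infsum_cong_neutral[where T="?N" and g="\<lambda>x'. \<nu> n x x' *\<^sub>R (x' - x)"]) auto
        have "D x \<bullet> v n x = - g x"
          using x SX
          by (intro gradient_drift_eq_neg_cost[OF dfl[OF n] _ lipschitz_on_continuous_on[OF K] int
                D(2)[unfolded G_def]]) auto
        then have "(\<Sum>x'\<in>?N. \<nu> n x x' * (G x' - G x)) \<le> - g x + M * \<rho>\<^sup>2 * exit_rate (S n) (\<nu> n) x"
          using generator_le_gradient_term[OF chain[OF n] x _ SX D bound M M0 nbrs[OF x] jump'[OF x]]
            domain[OF n] by (simp add: v)
        also have "M * \<rho>\<^sup>2 * exit_rate (S n) (\<nu> n) x \<le> M * \<rho>\<^sup>2 * (R1 * real n)"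
          using exit[OF n x] M0 by (intro mult_left_mono) auto
        also have "\<dots> = R1 * R2\<^sup>2 * C1 * g x + E"
          using n0 by (simp add: \<rho>(2) M_def E_def algebra_simps)
        also have "R1 * R2\<^sup>2 * C1 * g x \<le> 1 / 2 * g x"
        proof (intro mult_right_mono g)
          have "R1 * R2\<^sup>2 * C1 \<le> R1 * R2\<^sup>2 * c"
            using C1 params by (intro mult_left_mono) auto
          also have "\<dots> = 1 / 2"
            using params by (simp add: c_def)
          finally show "R1 * R2\<^sup>2 * C1 \<le> 1 / 2" .
        qed
        finally have "2 * (\<Sum>x'\<in>?N. \<nu> n x x' * (G x' - G x)) \<le> 2 * E - g x"
          by simp
        moreover have "(\<Sum>x'\<in>?N. \<nu> n x x' * (2 * G x' - 2 * G x))
            = 2 * (\<Sum>x'\<in>?N. \<nu> n x x' * (G x' - G x))"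
          by (simp add: sum_distrib_left algebra_simps)
        ultimately show ?thesis
          by simp
      qed
      show ?thesis
        using stationary_foster_bound[OF chain[OF n] stat[OF n] exit[OF n] nbrs sublevel g _ lyapunov] E
        by simp
    qed
    then have "(SUP n\<in>{n0..}. \<integral>\<^sup>+x. ennreal (g x) \<partial>measure_pmf (\<pi> n)) \<le> ennreal (2 * E)"
      by (intro SUP_least) auto
    then show ?thesis
      by (rule le_less_trans) simp
  qed
  ultimately show ?thesis
    by blast
qed

end
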